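(* Define sets of positive integers $R_1,R_2,\dots$ by $R_1=\{2\}$ and $R_{k+1}=\{(x+5)^2 : x\in R_k\}\cup\{x\in\mathbb{Z}_{>0}: x^2\in R_k\}$ for $k\geq 1$. Let $V=\{n\in\mathbb{Z}: n\geq 2,\ 5\nmid n\}$ and let $\Gamma_5$ be the directed graph on $V$ with up-edges $(n,(n+5)^2)$ and down-edges $(n^2,n)$ for $n\in V$. Let $a$ be a positive integer with $a<100$ such that $a\in R_i$ for some $i\leq 150$. Then there exists a directed path in $\Gamma_5$ from $2$ to $a$ all of whose vertices are at most $188^4$.
   Context: A directed path from $x$ to $y$ is a finite sequence of vertices $x=v_0,\dots,v_m=y$ with each $(v_{j-1},v_j)$ an edge of $\Gamma_5$. *)

theory Defs
  imports Main
begin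

text \<open>The sets R_k, indexed from 1; R 0 is an unused dummy (empty).\<close>
fun R :: "nat \<Rightarrow> int set" where
  "R 0 = {}"
| "R (Suc 0) = {2}"
| "R (Suc (Suc k)) = {(x + 5)^2 | x. x \<in> R (Suc k)} \<union> {x. x > 0 \<and> x^2 \<in> R (Suc k)}"

definition V5 :: "int set" where
  "V5 = {n. n \<ge> 2 \<and> \<not> (5 dvd n)}"

definition gamma5_edge :: "int \<Rightarrow> int \<Rightarrow> bool" where
  "gamma5_edge u v \<longleftrightarrow>
     (\<exists>n\<in>V5. u = n \<and> v = (n + 5)^2) \<or> (\<exists>n\<in>V5. u = n^2 \<and> v = n)"

definition gamma5_path :: "int list \<Rightarrow> int \<Rightarrow> int \<Rightarrow> bool" where
  "gamma5_path vs x y \<longleftrightarrow> vs \<noteq> [] \<and> hd vs = x \<and> last vs = y \<and> set vs \<subseteq> V5 \<and>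
     (\<forall>j. Suc j < length vs \<longrightarrow> gamma5_edge (vs ! j) (vs ! Suc j))"

end

theory Submission
  imports Defs
begin

text \<open>
  An up-edge followed by a down-edge is the move \<open>n \<rightarrow> n + 5\<close>. Combining this move with
  \<open>2 \<rightarrow> 49 \<rightarrow> 54\<^sup>2\<close>, \<open>56\<^sup>2 \<rightarrow> 56\<close>, \<open>81 \<rightarrow> 9 \<rightarrow> 14\<^sup>2\<close>, \<open>16\<^sup>2 \<rightarrow> 16 \<rightarrow> 4\<close>,
  \<open>36 \<rightarrow> 6\<close> and \<open>9 \<rightarrow> 3\<close> reaches one of 2, 3, 4, 6 in every nonzero class modulo 5, hence
  every vertex up to \<open>188\<^sup>2\<close>, without exceeding \<open>188\<^sup>4\<close>. Conversely every \<open>R k\<close> lies in the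
  vertex set.
\<close>

definition bounded_reachable :: "int \<Rightarrow> int \<Rightarrow> int \<Rightarrow> bool" where
  "bounded_reachable B x y \<longleftrightarrow> (\<exists>vs. gamma5_path vs x y \<and> (\<forall>v\<in>set vs. v \<le> B))"

lemma gamma5_path_snoc:
  assumes "gamma5_path vs x y" and "gamma5_edge y z" and "z \<in> V5"
  shows "gamma5_path (vs @ [z]) x z"
proof -
  have "gamma5_edge ((vs @ [z]) ! j) ((vs @ [z]) ! Suc j)" if "Suc j < length (vs @ [z])" for j
  proof (cases "Suc j < length vs")
    case True
    then show ?thesis using assms(1) by (auto simp: gamma5_path_def nth_append)
  next
    case False
    with that have "Suc j = length vs" by simp
    then have "j = length vs - 1" and "vs \<noteq> []" by auto
    then have "vs ! j = y" using assms(1) by (simp add: gamma5_path_def last_conv_nth)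
    then show ?thesis using assms(2) \<open>Suc j = length vs\<close> by (simp add: nth_append)
  qed
  then show ?thesis using assms by (auto simp: gamma5_path_def)
qed

lemma bounded_reachable_in_V5: "bounded_reachable B x y \<Longrightarrow> y \<in> V5"
  unfolding bounded_reachable_def gamma5_path_def using last_in_set by blast

lemma bounded_reachable_refl: "x \<in> V5 \<Longrightarrow> x \<le> B \<Longrightarrow> bounded_reachable B x x"
  unfolding bounded_reachable_def gamma5_path_def by (intro exI[of _ "[x]"]) simp

lemma bounded_reachable_edge:
  assumes "bounded_reachable B x y" and "gamma5_edge y z" and "z \<in> V5" and "z \<le> B"
  shows "bounded_reachable B x z"
proof -
  from assms(1) obtain vs where "gamma5_path vs x y" and "\<forall>v\<in>set vs. v \<le> B"
    unfolding bounded_reachable_def by blast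
  then show ?thesis
    unfolding bounded_reachable_def
    using gamma5_path_snoc assms(2-4) by (intro exI[of _ "vs @ [z]"]) auto
qed

lemma up_in_V5:
  assumes "n \<in> V5"
  shows "(n + 5)^2 \<in> V5"
proof -
  have "\<not> 5 dvd n" and "n \<ge> 2" using assms by (auto simp: V5_def)
  then have "n mod 5 = 1 \<or> n mod 5 = 2 \<or> n mod 5 = 3 \<or> n mod 5 = 4" by presburger
  then have "(n + 5)^2 mod 5 \<noteq> 0"
    using power_mod[of "n + 5" 5 2] by auto
  then have "\<not> 5 dvd (n + 5)^2" by (simp add: dvd_eq_mod_eq_0)
  moreover have "(n + 5)^2 \<ge> 2"
    using \<open>n \<ge> 2\<close> self_le_power[of "n + 5" 2] by simp
  ultimately show ?thesis by (simp add: V5_def)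
qed

lemma bounded_reachable_up:
  assumes "bounded_reachable B x n" and "(n + 5)^2 \<le> B"
  shows "bounded_reachable B x ((n + 5)^2)"
proof -
  have "n \<in> V5" using assms(1) by (rule bounded_reachable_in_V5)
  then have "gamma5_edge n ((n + 5)^2)" by (auto simp: gamma5_edge_def)
  then show ?thesis
    using assms up_in_V5[OF \<open>n \<in> V5\<close>] by (metis bounded_reachable_edge)
qed

lemma root_in_V5: "n > 0 \<Longrightarrow> n^2 \<in> V5 \<Longrightarrow> n \<in> V5"
  by (cases "n = 1") (auto simp: V5_def power2_eq_square)

lemma bounded_reachable_down:
  assumes "bounded_reachable B x (n^2)" and "n > 0" and "n \<le> B"
  shows "bounded_reachable B x n"
proof -
  have "n \<in> V5" using assms bounded_reachable_in_V5 root_in_V5 by blast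
  then have "gamma5_edge (n^2) n" by (auto simp: gamma5_edge_def)
  then show ?thesis
    using assms \<open>n \<in> V5\<close> by (metis bounded_reachable_edge)
qed

lemma bounded_reachable_add_5_mult:
  assumes "bounded_reachable (M^2) x n"
  shows "n + 5 * int k \<le> M \<Longrightarrow> bounded_reachable (M^2) x (n + 5 * int k)"
proof (induction k)
  case 0
  then show ?case using assms by simp
next
  case (Suc k)
  define m where "m = n + 5 * int k"
  have n: "n \<ge> 2" using bounded_reachable_in_V5[OF assms] by (simp add: V5_def)
  have le: "m + 5 \<le> M" and "m \<ge> 2" using Suc.prems n by (simp_all add: m_def)
  have "bounded_reachable (M^2) x m" using Suc by (simp add: m_def)
  moreover have "(m + 5)^2 \<le> M^2" using le \<open>m \<ge> 2\<close> by (intro power_mono) auto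
  ultimately have "bounded_reachable (M^2) x ((m + 5)^2)" by (rule bounded_reachable_up)
  moreover have "m + 5 \<le> M^2"
    using le \<open>m \<ge> 2\<close> self_le_power[of M 2] by simp
  ultimately have "bounded_reachable (M^2) x (m + 5)"
    using \<open>m \<ge> 2\<close> bounded_reachable_down[of "M^2" x "m + 5"] by simp
  then show ?case by (simp add: m_def algebra_simps)
qed

lemma bounded_reachable_same_residue:
  assumes "bounded_reachable (M^2) x n" and "n \<le> m" and "m mod 5 = n mod 5" and "m \<le> M"
  shows "bounded_reachable (M^2) x m"
proof -
  have "5 dvd m - n" using assms(3) by (simp add: mod_eq_dvd_iff)
  then obtain k where k: "m - n = 5 * k" by blast
  then have m: "n + 5 * int (nat k) = m" using assms(2) by simp
  show ?thesis using bounded_reachable_add_5_mult[OF assms(1), of "nat k"] assms(4) by (simp only: m)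
qed

lemma V5_bounded_reachable:
  assumes "a \<in> V5" and "a \<le> M" and M: "M \<ge> 3136"
  shows "bounded_reachable (M^2) 2 a"
proof -
  let ?P = "bounded_reachable (M^2) 2"
  have sq: "M \<le> M^2" using M self_le_power[of M 2] by simp
  note mv = bounded_reachable_same_residue
  have down: "?P n" if "?P (n^2)" "n > 0" "n \<le> 3136" for n
    using that M sq bounded_reachable_down[of "M^2" 2 n] by simp
  have up: "?P ((n + 5)^2)" if "?P n" "(n + 5)^2 \<le> 3136" for n
    using that M sq bounded_reachable_up[of "M^2" 2 n] by simp
  have 2: "?P 2" using M sq by (intro bounded_reachable_refl) (auto simp: V5_def)
  have "?P 49" using up[OF 2] by simp
  then have "?P 2916" using up[of 49] by simp
  then have "?P 3136" by (rule mv) (use M in auto)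
  then have "?P 56" using down[of 56] by simp
  then have "?P 81" by (rule mv) (use M in auto)
  then have 9: "?P 9" using down[of 9] by simp
  then have "?P 196" using up[of 9] by simp
  then have "?P 256" by (rule mv) (use M in auto)
  then have 16: "?P 16" using down[of 16] by simp
  then have "?P 36" by (rule mv) (use M in auto)
  then have 6: "?P 6" using down[of 6] by simp
  have 4: "?P 4" using 16 down[of 4] by simp
  have 3: "?P 3" using 9 down[of 3] by simp
  have "a \<ge> 2" and "\<not> 5 dvd a" using assms by (auto simp: V5_def)
  then have "(a mod 5 = 2 \<and> 2 \<le> a) \<or> (a mod 5 = 3 \<and> 3 \<le> a)
    \<or> (a mod 5 = 4 \<and> 4 \<le> a) \<or> (a mod 5 = 1 \<and> 6 \<le> a)"
    by presburger
  then show ?thesis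
    using mv[OF 2, of a] mv[OF 3, of a] mv[OF 4, of a] mv[OF 6, of a] assms by auto
qed

lemma R_subset_V5: "R k \<subseteq> V5"
proof (induction k rule: R.induct)
  case (3 k)
  then show ?case using up_in_V5 root_in_V5 by auto
qed (auto simp: V5_def)

theorem theorem14:
  fixes a :: int and i :: nat
  assumes "0 < a" and "a < 100" and "1 \<le> i" and "i \<le> 150" and "a \<in> R i"
  shows "\<exists>vs. gamma5_path vs 2 a \<and> (\<forall>v\<in>set vs. v \<le> 188^4)"
proof -
  have "bounded_reachable ((188^2)^2) 2 a"
    using V5_bounded_reachable[of a "188^2"] R_subset_V5 assms by auto
  then show ?thesis by (simp add: bounded_reachable_def)
qed

end
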